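(* Let $f:\mathbb{A}\to\mathbb{A}$ be a $C^1$ positive twist map and let $(f_t)_{t\in[0,1]}$ be an isotopy in $\mathrm{Diff}^1(\mathbb{A})$ joining the identity to $f$. Let $(0,1)\in T_z\mathbb{A}\setminus\{0\}$ denote the positive vertical unit tangent vector at each point $z\in\mathbb{A}$. Then, for any $z\in\mathbb{A}$ and any $n\in\mathbb{N}$, $n\neq 0$, $$\mathrm{Torsion}_n((f_t)_t,z,(0,1))\in(-\pi,0).$$
   Context: $\mathbb{T}=\mathbb{R}/2\pi\mathbb{Z}$ and $\mathbb{A}=\mathbb{T}\times\mathbb{R}$, with universal cover $\mathbb{R}^2\to\mathbb{A}$, $(x,y)\mapsto(x \bmod 2\pi,y)$, the standard flat metric, the standard trivialization of the tangent bundle and the counterclockwise orientation. An isotopy joining $\mathrm{Id}$ to $f$ is a path $(f_t)_{t\in[0,1]}$ in $\mathrm{Diff}^1(\mathbb{A})$, continuous for the weak (compact-open) $C^1$ topology, with $f_0=\mathrm{Id}$, $f_1=f$; it is extended to $t\ge 0$ by $f_t=f_{\{t\}}\circ f^{\lfloor t\rfloor}$, where $\{t\}$ is the fractional part and $\lfloor t\rfloor$ the integer part of $t$. A positive twist map is a $C^1$ diffeomorphism $f:\mathbb{A}\to\mathbb{A}$ isotopic to the identity such that for any lift $F:\mathbb{R}^2\to\mathbb{R}^2$ of $f$ and any $x\in\mathbb{R}$, the function $\mathbb{R}\ni y\mapsto p_1\circ F(x,y)\in\mathbb{R}$ is an increasing diffeomorphism of $\mathbb{R}$, where $p_1:\mathbb{R}^2\to\mathbb{R}$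 is the first coordinate projection. For $z\in\mathbb{A}$, $\xi\in T_z\mathbb{A}\setminus\{0\}$, let $\tilde v$ be a continuous lift to $\mathbb{R}$ of the function $t\mapsto\theta((0,1),Df_t(z)\xi)\in\mathbb{T}$, $t\geq 0$, where $\theta(u,w)\in\mathbb{T}$ denotes the oriented angle from $u$ to $w$. Then $\mathrm{Torsion}_n((f_t)_t,z,\xi)=\frac1n(\tilde v(n)-\tilde v(0))$ for $n\ge1$. *)

theory Defs
  imports "HOL-Analysis.Analysis" "HOL-Library.Real_Mod"
begin

section \<open>The annulus\<close>

quotient_type circle = real / "\<lambda>x y. [x = y] (rmod (2 * pi))"
  by (rule equivpI) (auto simp: rcong_def intro!: reflpI sympI transpI)

definition circle_proj :: "real \<Rightarrow> circle" where
  "circle_proj = abs_circle"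

lemma circle_proj_eq_iff: "circle_proj x = circle_proj y \<longleftrightarrow> [x = y] (rmod (2 * pi))"
  unfolding circle_proj_def by (rule circle.abs_eq_iff)

instantiation circle :: topological_space
begin

text \<open>Quotient topology.\<close>

definition open_circle :: "circle set \<Rightarrow> bool" where
  "open_circle U \<longleftrightarrow> open (circle_proj -` U)"

instance
proof
  fix K :: "circle set set"
  assume "\<forall>U\<in>K. open U"
  then show "open (\<Union>K)"
    by (auto simp: open_circle_def vimage_Union)
qed (auto simp: open_circle_def)

end

type_synonym plane = "real \<times> real"
type_synonym annulus = "circle \<times> real"

definition annulus_proj :: "plane \<Rightarrow> annulus" where
  "annulus_proj w = (circle_proj (fst w), snd w)"


section \<open>Differential calculus on the annulus\<close>

text \<open>
  Tangent spaces are identified with the plane by the standard trivialization. The derivative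
  is taken in the charts given by local inverses of the covering map: near \<open>w\<close>, the map \<open>G\<close>
  is \<open>f\<close> read in such charts.
\<close>

definition has_annulus_derivative ::
    "(annulus \<Rightarrow> annulus) \<Rightarrow> (plane \<Rightarrow>\<^sub>L plane) \<Rightarrow> annulus \<Rightarrow> bool" where
  "has_annulus_derivative f L z \<longleftrightarrow>
     (\<exists>w G. annulus_proj w = z
        \<and> (\<forall>\<^sub>F u in nhds w. annulus_proj (G u) = f (annulus_proj u))
        \<and> (G has_derivative blinfun_apply L) (at w))"

definition annulus_deriv :: "(annulus \<Rightarrow> annulus) \<Rightarrow> annulus \<Rightarrow> (plane \<Rightarrow>\<^sub>L plane)" where
  "annulus_deriv f z = (THE L. has_annulus_derivative f L z)"

definition C1_map :: "(annulus \<Rightarrow> annulus) \<Rightarrow> bool" where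
  "C1_map f \<longleftrightarrow>
     (\<exists>D. (\<forall>z. has_annulus_derivative f (D z) z) \<and> continuous_on UNIV D)"

definition Diff1 :: "(annulus \<Rightarrow> annulus) set" where
  "Diff1 = {f. bij f \<and> C1_map f \<and> C1_map (inv f)}"

text \<open>
  The weak topology on \<open>Diff1\<close> is induced from the compact-open topology by the 1-jet map
  \<open>g \<mapsto> (z \<mapsto> (g z, Dg(z)))\<close>, that is, it is the topology of convergence, uniform on compact
  sets, of maps together with their derivatives.
\<close>

definition weak_C1_topology :: "(annulus \<Rightarrow> annulus) topology" where
  "weak_C1_topology = topology_generated_by
     {{g \<in> Diff1. (\<lambda>z. (g z, annulus_deriv g z)) ` K \<subseteq> U} | K U. compact K \<and> open U}"

lemma topspace_weak_C1_topology: "topspace weak_C1_topology = Diff1"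
proof -
  let ?N = "\<lambda>K U. {g \<in> Diff1. (\<lambda>z. (g z, annulus_deriv g z)) ` K \<subseteq> U}"
  have "?N {} UNIV \<in> {?N K U | K U. compact K \<and> open U}"
    using compact_empty open_UNIV by blast
  moreover have "?N {} UNIV = Diff1"
    by simp
  ultimately show ?thesis
    unfolding weak_C1_topology_def topology_generated_by_topspace by blast
qed

definition isotopy_from_id :: "(real \<Rightarrow> annulus \<Rightarrow> annulus) \<Rightarrow> (annulus \<Rightarrow> annulus) \<Rightarrow> bool" where
  "isotopy_from_id \<phi> f \<longleftrightarrow>
     continuous_map (top_of_set {0..1}) weak_C1_topology \<phi> \<and> \<phi> 0 = id \<and> \<phi> 1 = f"

text \<open>Extension of an isotopy to all times \<open>t \<ge> 0\<close>.\<close>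

definition extend_isotopy :: "(real \<Rightarrow> annulus \<Rightarrow> annulus) \<Rightarrow> real \<Rightarrow> annulus \<Rightarrow> annulus" where
  "extend_isotopy \<phi> t = \<phi> (frac t) \<circ> (\<phi> 1 ^^ nat \<lfloor>t\<rfloor>)"


section \<open>Positive twist maps\<close>

definition is_lift :: "(plane \<Rightarrow> plane) \<Rightarrow> (annulus \<Rightarrow> annulus) \<Rightarrow> bool" where
  "is_lift F f \<longleftrightarrow> continuous_on UNIV F \<and> (\<forall>w. annulus_proj (F w) = f (annulus_proj w))"

definition increasing_diffeo :: "(real \<Rightarrow> real) \<Rightarrow> bool" where
  "increasing_diffeo g \<longleftrightarrow>
     strict_mono g \<and> bij g \<and> g C1_differentiable_on UNIV \<and> inv g C1_differentiable_on UNIV"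

definition positive_twist_map :: "(annulus \<Rightarrow> annulus) \<Rightarrow> bool" where
  "positive_twist_map f \<longleftrightarrow>
     f \<in> Diff1 \<and> (\<exists>\<phi>. isotopy_from_id \<phi> f) \<and>
     (\<forall>F x. is_lift F f \<longrightarrow> increasing_diffeo (\<lambda>y. fst (F (x, y))))"


section \<open>Torsion\<close>

text \<open>Oriented (counterclockwise) angle from \<open>u\<close> to \<open>w\<close>, for nonzero \<open>u\<close> and \<open>w\<close>.\<close>

definition oriented_angle :: "plane \<Rightarrow> plane \<Rightarrow> circle" where
  "oriented_angle u w =
     circle_proj (Arg (Complex (fst w) (snd w) / Complex (fst u) (snd u)))"

definition is_angle_lift ::
    "(real \<Rightarrow> annulus \<Rightarrow> annulus) \<Rightarrow> annulus \<Rightarrow> plane \<Rightarrow> (real \<Rightarrow> real) \<Rightarrow> bool" where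
  "is_angle_lift \<phi> z \<xi> v \<longleftrightarrow>
     continuous_on {0..} v \<and>
     (\<forall>t\<ge>0. circle_proj (v t) =
        oriented_angle (0, 1) (blinfun_apply (annulus_deriv (extend_isotopy \<phi> t) z) \<xi>))"

text \<open>
  For an isotopy \<open>\<phi>\<close> and \<open>\<xi> \<noteq> 0\<close>, angle lifts exist and any two of them differ by a constant
  on \<open>{0..}\<close>, so that the value does not depend on the choice.
\<close>

definition torsion ::
    "nat \<Rightarrow> (real \<Rightarrow> annulus \<Rightarrow> annulus) \<Rightarrow> annulus \<Rightarrow> plane \<Rightarrow> real" where
  "torsion n \<phi> z \<xi> =
     (let v = (SOME v. is_angle_lift \<phi> z \<xi> v) in (v (real n) - v 0) / real n)"

end

theory Submission
  imports Defs
begin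

text \<open>
  Lift the isotopy to the plane. Chords \<open>F\<^sub>t(a) - F\<^sub>t(b)\<close> never vanish, and the chord for
  \<open>b = a - (2\<pi>, 0)\<close> is constant in time. Deform it to the vertical direction at \<open>a\<close>: first
  lower \<open>b\<close> far enough, then move \<open>b\<close> horizontally below \<open>a\<close>, then raise it to \<open>a\<close>. At time \<open>0\<close> the chord
  stays in the closed first quadrant, and at time \<open>1\<close> it points to the right by the twist condition.
  Hence, independently of the isotopy, the vertical vector ends up on the right without any full
  turn, that is, rotated by an angle in \<open>(-\<pi>, 0)\<close>. For \<open>n\<close> steps, the image of the vertical vector is
  compared at each step with the vertical vector at \<open>f\<^sup>n z\<close>: linear isomorphisms preserve the position
  of the angle between them relative to the multiples of \<open>\<pi>\<close>.
\<close>

section \<open>Local lifts and derivatives\<close>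

declare split_paired_All [simp del] split_paired_Ex [simp del]

section \<open>The covering map and the circle as a set of unit complex numbers\<close>

lemma circle_proj_eq_iff_cis: "circle_proj a = circle_proj b \<longleftrightarrow> cis a = cis b"
  by (simp add: circle_proj_eq_iff cis_eq_iff)

lemma circle_proj_surj: "\<exists>x. circle_proj x = c"
  unfolding circle_proj_def by (metis Quotient3_abs_rep[OF Quotient3_circle])

lemma annulus_proj_surj: obtains w where "annulus_proj w = z"
proof -
  obtain x where "circle_proj x = fst z"
    using circle_proj_surj by blast
  then show ?thesis
    by (intro that[of "(x, snd z)"]) (simp add: annulus_proj_def)
qed

lemma annulus_proj_eq_iff:
  "annulus_proj u = annulus_proj w \<longleftrightarrow> (\<exists>k::int. w = u + (of_int k * (2 * pi), 0))"
  by (cases u; cases w) (auto simp: annulus_proj_def circle_proj_eq_iff rcong_altdef)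

lemma continuous_on_circle_proj: "continuous_on UNIV circle_proj"
  by (simp add: continuous_on_open_vimage open_circle_def)

lemma continuous_on_annulus_proj: "continuous_on A annulus_proj"
  unfolding annulus_proj_def
  by (intro continuous_intros continuous_on_compose2[OF continuous_on_circle_proj]) auto

lemma isCont_annulus_proj: "isCont annulus_proj w"
  using continuous_on_annulus_proj[of UNIV] by (simp add: continuous_on_eq_continuous_at)

text \<open>The standard embedding into the complex plane; \<open>cis\<close> has period
  \<open>2 * pi\<close>, so the chosen representative does not matter. It reduces lifting
  circle-valued maps to finding continuous logarithms.\<close>

definition circle_cis :: "circle \<Rightarrow> complex" where
  "circle_cis c = cis (SOME x. circle_proj x = c)"

lemma circle_cis_proj [simp]: "circle_cis (circle_proj x) = cis x"
proof -
  have "circle_proj (SOME y. circle_proj y = circle_proj x) = circle_proj x"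
    by (rule someI) simp
  then show ?thesis
    by (simp add: circle_cis_def circle_proj_eq_iff_cis)
qed

lemma circle_cis_inject: "circle_cis c = circle_cis d \<Longrightarrow> c = d"
  using circle_proj_surj[of c] circle_proj_surj[of d]
  by (auto simp: circle_proj_eq_iff_cis)

lemma continuous_on_circle_cis: "continuous_on UNIV circle_cis"
proof -
  have "open (circle_cis -` U)" if "open U" for U
  proof -
    have "circle_proj -` (circle_cis -` U) = cis -` U"
      by auto
    moreover have "continuous_on UNIV cis"
      by (intro continuous_intros)
    ultimately show ?thesis
      using that by (simp add: open_circle_def continuous_on_open_vimage)
  qed
  then show ?thesis
    by (simp add: continuous_on_open_vimage)
qed

section \<open>Local lifts and uniqueness of the derivative\<close>

lemma eventually_nhds_translate:
  fixes w d :: "'a::real_normed_vector"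
  assumes "\<forall>\<^sub>F u in nhds (w + d). P u"
  shows "\<forall>\<^sub>F u in nhds w. P (u + d)"
proof -
  have "((\<lambda>u. u + d) \<longlongrightarrow> w + d) (nhds w)"
    by (intro tendsto_intros filterlim_ident)
  then show ?thesis
    using assms by (rule eventually_compose_filterlim[rotated])
qed

text \<open>The difference of two local lifts is continuous at the base point with values in a lattice.\<close>

lemma local_lifts_differ_by_const:
  fixes G H :: "plane \<Rightarrow> plane"
  assumes "isCont G w" "isCont H w'" "annulus_proj w = annulus_proj w'"
    and G: "\<forall>\<^sub>F u in nhds w. annulus_proj (G u) = f (annulus_proj u)"
    and H: "\<forall>\<^sub>F u in nhds w'. annulus_proj (H u) = f (annulus_proj u)"
  obtains c where "\<forall>\<^sub>F u in nhds w. G u = H (u + (w' - w)) + c"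
proof -
  define D where "D u = G u - H (u + (w' - w))" for u
  have "isCont (\<lambda>u. H (u + (w' - w))) w"
    by (rule isCont_o2[where g = H]) (use assms(2) in auto)
  then have "isCont D w"
    unfolding D_def using assms(1) by (intro continuous_intros)
  then have "(D \<longlongrightarrow> D w) (nhds w)"
    by (simp add: isCont_def tendsto_at_iff_tendsto_nhds)
  \<comment> \<open>Distinct deck translations are at least \<open>2 * pi\<close> apart, so this
    bound will force \<open>D u = D w\<close>.\<close>
  then have near: "\<forall>\<^sub>F u in nhds w. dist (D u) (D w) < 2 * pi"
    by (rule tendstoD) simp
  obtain m :: int where m: "w' = w + (of_int m * (2 * pi), 0)"
    using assms(3) by (auto simp: annulus_proj_eq_iff)
  have shift: "annulus_proj (u + (w' - w)) = annulus_proj u" for u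
    unfolding m by (subst eq_commute, subst annulus_proj_eq_iff) auto
  have "\<forall>\<^sub>F u in nhds w. annulus_proj (H (u + (w' - w))) = f (annulus_proj (u + (w' - w)))"
    by (rule eventually_nhds_translate) (use H in simp)
  with G have "\<forall>\<^sub>F u in nhds w. annulus_proj (H (u + (w' - w))) = annulus_proj (G u)"
    by eventually_elim (simp add: shift)
  then have lat: "\<forall>\<^sub>F u in nhds w. \<exists>k::int. D u = (of_int k * (2 * pi), 0)"
    by eventually_elim (auto simp: annulus_proj_eq_iff D_def)
  from eventually_nhds_x_imp_x[OF lat] obtain k0 :: int
    where k0: "D w = (of_int k0 * (2 * pi), 0)" ..
  from near lat have "\<forall>\<^sub>F u in nhds w. D u = D w"
  proof eventually_elim
    case (elim u)
    then obtain k :: int where k: "D u = (of_int k * (2 * pi), 0)"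
      by blast
    have "dist (D u) (D w) = \<bar>of_int k * (2 * pi) - of_int k0 * (2 * pi)\<bar>"
      unfolding k k0 by (simp add: dist_Pair_Pair dist_real_def)
    also have "\<dots> = \<bar>of_int (k - k0)\<bar> * (2 * pi)"
      by (simp add: abs_mult flip: left_diff_distrib)
    finally have "\<bar>of_int (k - k0)\<bar> * (2 * pi) < 1 * (2 * pi)"
      using elim by simp
    then have "\<bar>of_int (k - k0) :: real\<bar> < 1"
      by (subst (asm) mult_less_cancel_right_pos) auto
    then have "k = k0"
      by linarith
    then show ?case
      by (simp add: k k0)
  qed
  then have "\<forall>\<^sub>F u in nhds w. G u = H (u + (w' - w)) + D w"
    by eventually_elim (simp add: D_def algebra_simps)
  then show ?thesis
    by (rule that)
qed

text \<open>The definition supplies only some local lift. Any other continuous one agrees with it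
  near the base point up to translations in the source and in the target, which do not affect the
  derivative.\<close>

lemma has_annulus_derivative_local_lift:
  assumes "has_annulus_derivative f L (annulus_proj w)" "isCont G w"
    and "\<forall>\<^sub>F u in nhds w. annulus_proj (G u) = f (annulus_proj u)"
  shows "(G has_derivative blinfun_apply L) (at w)"
proof -
  obtain w' H where H: "annulus_proj w = annulus_proj w'"
      "\<forall>\<^sub>F u in nhds w'. annulus_proj (H u) = f (annulus_proj u)"
      "(H has_derivative blinfun_apply L) (at w')"
    using assms(1) unfolding has_annulus_derivative_def by metis
  obtain c where c: "\<forall>\<^sub>F u in nhds w. G u = H (u + (w' - w)) + c"
    using local_lifts_differ_by_const[OF assms(2) has_derivative_continuous[OF H(3)] H(1) assms(3) H(2)] .
  have "((\<lambda>u. H (u + (w' - w)) + c) has_derivative blinfun_apply L) (at w)"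
  proof -
    have "((\<lambda>u. H (u + (w' - w))) has_derivative (\<lambda>h. blinfun_apply L h)) (at w)"
      by (rule has_derivative_compose[where f = "\<lambda>u. u + (w' - w)" and f' = "\<lambda>h. h"])
         (use H(3) in \<open>auto intro!: derivative_eq_intros\<close>)
    then show ?thesis
      by (auto intro!: derivative_eq_intros)
  qed
  moreover have "H (w + (w' - w)) + c = G w"
    using eventually_nhds_x_imp_x[OF c] by (rule sym)
  moreover have "\<forall>\<^sub>F u in at w. H (u + (w' - w)) + c = G u"
    using c unfolding eventually_at_filter by eventually_elim simp
  ultimately show ?thesis
    using has_derivative_transform_eventually[OF _ _ _ UNIV_I] by blast
qed

text \<open>The local lift witnessing \<open>L\<close> must also have derivative \<open>M\<close>.
  This gives meaning to the definite description in \<open>annulus_deriv\<close>.\<close>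

lemma has_annulus_derivative_unique:
  assumes "has_annulus_derivative f L z" "has_annulus_derivative f M z"
  shows "L = M"
proof -
  obtain w G where G: "annulus_proj w = z"
      "\<forall>\<^sub>F u in nhds w. annulus_proj (G u) = f (annulus_proj u)"
      "(G has_derivative blinfun_apply L) (at w)"
    using assms(1) by (auto simp: has_annulus_derivative_def)
  have "(G has_derivative blinfun_apply M) (at w)"
    by (rule has_annulus_derivative_local_lift)
       (use assms(2) G has_derivative_continuous[OF G(3)] in auto)
  with G(3) have "blinfun_apply L = blinfun_apply M"
    by (rule has_derivative_unique)
  then show ?thesis
    by (simp add: blinfun_apply_inject)
qed

lemma annulus_deriv_eq: "has_annulus_derivative f L z \<Longrightarrow> annulus_deriv f z = L"
  unfolding annulus_deriv_def by (rule the_equality) (auto intro: has_annulus_derivative_unique)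

lemma has_annulus_derivative_id: "has_annulus_derivative id id_blinfun z"
proof -
  obtain w where "annulus_proj w = z"
    by (rule annulus_proj_surj)
  then show ?thesis
    unfolding has_annulus_derivative_def
    by (intro exI[of _ w] exI[of _ "\<lambda>u. u"]) (auto simp: has_derivative_ident)
qed

lemma has_annulus_derivative_compose:
  assumes f: "has_annulus_derivative f L z" and g: "has_annulus_derivative g M (f z)"
  shows "has_annulus_derivative (g \<circ> f) (M o\<^sub>L L) z"
proof -
  obtain w G where G: "annulus_proj w = z"
      "\<forall>\<^sub>F u in nhds w. annulus_proj (G u) = f (annulus_proj u)"
      "(G has_derivative blinfun_apply L) (at w)"
    using f by (auto simp: has_annulus_derivative_def)
  obtain w' H where H: "annulus_proj w' = f z"
      "\<forall>\<^sub>F u in nhds w'. annulus_proj (H u) = g (annulus_proj u)"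
      "(H has_derivative blinfun_apply M) (at w')"
    using g by (auto simp: has_annulus_derivative_def)
  have Gw: "annulus_proj (G w) = annulus_proj w'"
    using eventually_nhds_x_imp_x[OF G(2)] G(1) H(1) by simp
  \<comment> \<open>The lift \<open>H\<close> is given near \<open>w'\<close>, which may differ from
    \<open>G w\<close>; this deck translation makes the two lifts composable.\<close>
  define d where "d = w' - G w"
  obtain m :: int where m: "w' = G w + (of_int m * (2 * pi), 0)"
    using Gw by (auto simp: annulus_proj_eq_iff)
  have shift: "annulus_proj (u + d) = annulus_proj u" for u
    unfolding d_def m by (subst eq_commute, subst annulus_proj_eq_iff) auto
  have "(G \<longlongrightarrow> G w) (nhds w)"
    using has_derivative_continuous[OF G(3)]
    by (simp add: isCont_def tendsto_at_iff_tendsto_nhds)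
  moreover have "\<forall>\<^sub>F u in nhds (G w). annulus_proj (H (u + d)) = g (annulus_proj (u + d))"
    by (rule eventually_nhds_translate) (use H(2) in \<open>simp add: d_def\<close>)
  ultimately have "\<forall>\<^sub>F u in nhds w. annulus_proj (H (G u + d)) = g (annulus_proj (G u + d))"
    by (rule eventually_compose_filterlim[rotated])
  then have "\<forall>\<^sub>F u in nhds w. annulus_proj (H (G u + d)) = (g \<circ> f) (annulus_proj u)"
    using G(2) by eventually_elim (simp add: shift)
  moreover have "((\<lambda>u. H (G u + d)) has_derivative blinfun_apply (M o\<^sub>L L)) (at w)"
  proof -
    have "((\<lambda>u. G u + d) has_derivative blinfun_apply L) (at w)"
      using G(3) by (auto intro!: derivative_eq_intros)
    then have "((\<lambda>u. H (G u + d)) has_derivative (\<lambda>h. blinfun_apply M (blinfun_apply L h))) (at w)"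
      by (rule has_derivative_compose) (use H(3) in \<open>simp add: d_def\<close>)
    then show ?thesis
      by (simp add: blinfun_compose.rep_eq comp_def)
  qed
  ultimately show ?thesis
    unfolding has_annulus_derivative_def using G(1)
    by (intro exI[of _ w] exI[of _ "\<lambda>u. H (G u + d)"]) auto
qed

lemma isCont_has_annulus_derivative:
  assumes "has_annulus_derivative f L (annulus_proj w)"
  shows "isCont (\<lambda>u. f (annulus_proj u)) w"
proof -
  obtain w' H where H: "annulus_proj w' = annulus_proj w"
      "\<forall>\<^sub>F u in nhds w'. annulus_proj (H u) = f (annulus_proj u)"
      "(H has_derivative blinfun_apply L) (at w')"
    using assms by (auto simp: has_annulus_derivative_def)
  obtain m :: int where m: "w' = w + (of_int m * (2 * pi), 0)"
    using H(1)[symmetric] by (auto simp: annulus_proj_eq_iff)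
  have shift: "annulus_proj (u + (w' - w)) = annulus_proj u" for u
    unfolding m by (subst eq_commute, subst annulus_proj_eq_iff) auto
  have "isCont (\<lambda>u. H (u + (w' - w))) w"
    by (rule isCont_o2[where g = H]) (use has_derivative_continuous[OF H(3)] in auto)
  then have "isCont (\<lambda>u. annulus_proj (H (u + (w' - w)))) w"
    using isCont_annulus_proj by (rule isCont_o2)
  moreover have "\<forall>\<^sub>F u in nhds w. annulus_proj (H (u + (w' - w))) = f (annulus_proj (u + (w' - w)))"
    by (rule eventually_nhds_translate) (use H(2) in simp)
  then have "\<forall>\<^sub>F u in nhds w. annulus_proj (H (u + (w' - w))) = f (annulus_proj u)"
    by (simp add: shift)
  ultimately show ?thesis
    by (subst (asm) isCont_cong) auto
qed

lemma Diff1_has_derivative: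
  assumes "f \<in> Diff1"
  shows "has_annulus_derivative f (annulus_deriv f z) z"
    and "continuous_on UNIV (annulus_deriv f)"
proof -
  obtain D where D: "\<And>z. has_annulus_derivative f (D z) z" "continuous_on UNIV D"
    using assms by (auto simp: Diff1_def C1_map_def)
  have "annulus_deriv f = D"
    using annulus_deriv_eq[OF D(1)] by auto
  then show "has_annulus_derivative f (annulus_deriv f z) z"
    and "continuous_on UNIV (annulus_deriv f)"
    using D by simp_all
qed

text \<open>The chain rule for \<open>inv f \<circ> f = id\<close> provides a left inverse of the
  derivative.\<close>

lemma Diff1_deriv_inject:
  assumes "f \<in> Diff1"
  shows "inj (blinfun_apply (annulus_deriv f z))"
proof -
  have f: "has_annulus_derivative f (annulus_deriv f z) z"
    using assms by (rule Diff1_has_derivative)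
  obtain M where M: "has_annulus_derivative (inv f) M (f z)"
    using assms by (auto simp: Diff1_def C1_map_def)
  have "inv f \<circ> f = id"
    using assms by (simp add: Diff1_def bij_is_inj)
  then have "M o\<^sub>L annulus_deriv f z = id_blinfun"
    using has_annulus_derivative_compose[OF f M] has_annulus_derivative_id
    by (metis has_annulus_derivative_unique)
  then have "blinfun_apply (M o\<^sub>L annulus_deriv f z) h = blinfun_apply id_blinfun h" for h
    by (rule arg_cong)
  then have "blinfun_apply M (blinfun_apply (annulus_deriv f z) h) = h" for h
    by simp
  then show ?thesis
    by (rule inj_on_inverseI)
qed


section \<open>Lifting isotopies\<close>

text \<open>\<open>h\<close> takes values in the discrete set of integer multiples of
  \<open>2 * pi * \<i>\<close>. This serves to compare two continuous logarithms of one
  function.\<close>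

lemma exp_eq_1_imp_constant:
  fixes h :: "'a::topological_space \<Rightarrow> complex"
  assumes "connected S" "continuous_on S h" "\<And>x. x \<in> S \<Longrightarrow> exp (h x) = 1" "x \<in> S" "y \<in> S"
  shows "h x = h y"
proof -
  have "h constant_on S"
  proof (rule continuous_discrete_range_constant[OF assms(1,2)])
    fix x assume x: "x \<in> S"
    have "2 * pi \<le> norm (h y - h x)" if "y \<in> S" "h y \<noteq> h x" for y
    proof (rule ccontr)
      assume "\<not> 2 * pi \<le> norm (h y - h x)"
      then have "\<bar>Im (h y) - Im (h x)\<bar> < 2 * pi"
        using abs_Im_le_cmod[of "h y - h x"] by simp
      then show False
        using exp_complex_eqI assms(3)[OF x] assms(3)[OF that(1)] that(2) by metis
    qed
    then show "\<exists>e>0. \<forall>y. y \<in> S \<and> h y \<noteq> h x \<longrightarrow> e \<le> norm (h y - h x)"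
      by (intro exI[of _ "2 * pi"]) auto
  qed
  then show ?thesis
    using assms(4,5) by (metis constant_on_def)
qed

locale isotopy =
  fixes \<phi> :: "real \<Rightarrow> annulus \<Rightarrow> annulus" and f :: "annulus \<Rightarrow> annulus"
  assumes isotopy: "isotopy_from_id \<phi> f"
begin

lemma at_0: "\<phi> 0 = id" and at_1: "\<phi> 1 = f"
  using isotopy by (auto simp: isotopy_from_id_def)

lemma in_Diff1: "t \<in> {0..1} \<Longrightarrow> \<phi> t \<in> Diff1"
  using isotopy by (auto simp: isotopy_from_id_def continuous_map_def topspace_weak_C1_topology)

text \<open>The weak topology controls jets on compact sets only; since the plane is locally
  compact, this is enough for continuity jointly in time and point.\<close>

lemma continuous_on_jet:
  "continuous_on ({0..1} \<times> UNIV)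
     (\<lambda>x. (\<phi> (fst x) (annulus_proj (snd x)), annulus_deriv (\<phi> (fst x)) (annulus_proj (snd x))))"
    (is "continuous_on _ ?J")
  unfolding continuous_on_def
proof
  fix x :: "real \<times> plane"
  assume "x \<in> {0..1} \<times> UNIV"
  then obtain t w where x: "x = (t, w)" and t: "t \<in> {0..1}"
    by auto
  show "(?J \<longlongrightarrow> ?J x) (at x within {0..1} \<times> UNIV)"
  proof (rule topological_tendstoI)
    fix U :: "(annulus \<times> (plane \<Rightarrow>\<^sub>L plane)) set"
    assume U: "open U" "?J x \<in> U"
    let ?j = "\<lambda>g z. (g z, annulus_deriv g z)"
    have "continuous_on UNIV (\<lambda>u. annulus_deriv (\<phi> t) (annulus_proj u))"
      using Diff1_has_derivative(2)[OF in_Diff1[OF t]] continuous_on_annulus_proj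
      by (rule continuous_on_compose2) simp
    then have "isCont (\<lambda>u. annulus_deriv (\<phi> t) (annulus_proj u)) w"
      by (simp add: continuous_on_eq_continuous_at)
    then have "isCont (\<lambda>u. ?j (\<phi> t) (annulus_proj u)) w"
      using isCont_has_annulus_derivative[OF Diff1_has_derivative(1)[OF in_Diff1[OF t]]]
      by (intro isCont_Pair)
    then have "((\<lambda>u. ?j (\<phi> t) (annulus_proj u)) \<longlongrightarrow> ?j (\<phi> t) (annulus_proj w)) (nhds w)"
      unfolding isCont_def
      by (rule tendsto_at_iff_tendsto_nhds[THEN iffD1, where g1 = "\<lambda>u. ?j (\<phi> t) (annulus_proj u)"])
    then have "\<forall>\<^sub>F u in nhds w. ?j (\<phi> t) (annulus_proj u) \<in> U"
      using U by (intro topological_tendstoD) (auto simp: x)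
    then obtain \<delta> where \<delta>: "\<delta> > 0" "\<And>u. dist u w < \<delta> \<Longrightarrow> ?j (\<phi> t) (annulus_proj u) \<in> U"
      by (auto simp: eventually_nhds_metric)
    \<comment> \<open>Halving the radius puts a compact ball inside the region controlled by
      \<open>\<delta>\<close>; its projection defines a neighbourhood of \<open>\<phi> t\<close> in
      the weak topology.\<close>
    define K where "K = annulus_proj ` cball w (\<delta> / 2)"
    have "compact K"
      unfolding K_def by (intro compact_continuous_image continuous_on_annulus_proj compact_cball)
    define N where "N = {g \<in> Diff1. ?j g ` K \<subseteq> U}"
    have N: "openin weak_C1_topology N"
      unfolding weak_C1_topology_def N_def using \<open>compact K\<close> U(1)
      by (intro topology_generated_by_Basis) blast
    have cont: "continuous_map (top_of_set {0..1}) weak_C1_topology \<phi>"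
      using isotopy by (simp add: isotopy_from_id_def)
    have "openin (top_of_set {0..1}) {s \<in> {0..1}. \<phi> s \<in> N}"
      using openin_continuous_map_preimage[OF cont N] by simp
    then obtain T where T: "open T" "{s \<in> {0..1}. \<phi> s \<in> N} = {0..1} \<inter> T"
      unfolding openin_open by blast
    have "\<phi> t \<in> N"
      unfolding N_def K_def using in_Diff1[OF t] \<delta>(1)
      by (intro CollectI conjI image_subsetI) (auto intro!: \<delta>(2) simp: dist_commute)
    then have "t \<in> {0..1} \<inter> T"
      unfolding T(2)[symmetric] using t by simp
    then have "t \<in> T" ..
    show "\<forall>\<^sub>F y in at x within {0..1} \<times> UNIV. ?J y \<in> U"
      unfolding eventually_at_topological
    proof (intro exI conjI ballI impI)
      show "open (T \<times> ball w (\<delta> / 2))"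
        using T by (intro open_Times) auto
      show "x \<in> T \<times> ball w (\<delta> / 2)"
        using \<open>t \<in> T\<close> \<delta> by (simp add: x)
      fix y assume y: "y \<in> T \<times> ball w (\<delta> / 2)" "y \<in> {0..1} \<times> (UNIV :: plane set)"
      then have "fst y \<in> {s \<in> {0..1}. \<phi> s \<in> N}"
        unfolding T(2) by (simp add: mem_Times_iff)
      then have "\<phi> (fst y) \<in> N"
        by blast
      moreover have "annulus_proj (snd y) \<in> K"
        unfolding K_def using y by (auto simp: mem_Times_iff)
      ultimately show "?J y \<in> U"
        unfolding N_def by blast
    qed
  qed
qed

lemma continuous_on_value:
  "continuous_on ({0..1} \<times> UNIV) (\<lambda>x. \<phi> (fst x) (annulus_proj (snd x)))"
  using continuous_on_fst[OF continuous_on_jet] by simp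

lemma continuous_on_deriv:
  "continuous_on ({0..1} \<times> UNIV) (\<lambda>x. annulus_deriv (\<phi> (fst x)) (annulus_proj (snd x)))"
  using continuous_on_snd[OF continuous_on_jet] by simp

lemma continuous_on_deriv_time: "continuous_on {0..1} (\<lambda>t. annulus_deriv (\<phi> t) z)"
proof -
  obtain w where w: "annulus_proj w = z"
    by (rule annulus_proj_surj)
  have "continuous_on {0..1} (\<lambda>t. annulus_deriv (\<phi> (fst (t, w))) (annulus_proj (snd (t, w))))"
    by (rule continuous_on_compose2[OF continuous_on_deriv]) (auto intro!: continuous_intros)
  then show ?thesis
    by (simp add: w)
qed

end

section \<open>Lifts of an isotopy to the plane\<close>

locale lifted_isotopy = isotopy +
  fixes F :: "real \<Rightarrow> plane \<Rightarrow> plane"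
  assumes continuous_on_lift: "continuous_on ({0..1} \<times> UNIV) (\<lambda>x. F (fst x) (snd x))"
    and proj_lift: "\<And>t w. t \<in> {0..1} \<Longrightarrow> annulus_proj (F t w) = \<phi> t (annulus_proj w)"
    and lift_0: "\<And>w. F 0 w = w"

text \<open>The angular coordinate, as a unit complex number, has a continuous logarithm on the
  contractible set \<open>{0..1} \<times> UNIV\<close>; its imaginary part lifts that
  coordinate.\<close>

lemma (in isotopy) ex_lifted_isotopy: "\<exists>F. lifted_isotopy \<phi> f F"
proof -
  let ?S = "{0..1} \<times> UNIV :: (real \<times> plane) set"
  let ?E = "\<lambda>x. circle_cis (fst (\<phi> (fst x) (annulus_proj (snd x))))"
  have norm_E: "norm (?E x) = 1" for x
    by (simp add: circle_cis_def)
  have log: "continuous_on ?S ?E"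
    by (rule continuous_on_compose2[OF continuous_on_circle_cis])
       (auto intro!: continuous_on_fst continuous_on_value)
  have ctr: "contractible ?S"
    by (intro convex_imp_contractible convex_Times) auto
  have nz: "?E x \<noteq> 0" for x
    using norm_E[of x] by (metis norm_zero zero_neq_one)
  obtain g where g: "continuous_on ?S g" "\<And>x. x \<in> ?S \<Longrightarrow> ?E x = exp (g x)"
    by (rule continuous_logarithm_on_contractible[OF log ctr nz], rule that) simp_all
  have cis_g: "cis (Im (g x)) = ?E x" if "x \<in> ?S" for x
  proof -
    have "exp (Re (g x)) = 1"
      using norm_E[of x] g(2)[OF that] by (metis norm_exp_eq_Re)
    then show ?thesis
      by (simp add: g(2)[OF that] exp_eq_polar)
  qed
  \<comment> \<open>The subtracted term is a multiple of \<open>2 * pi\<close> independent of time: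
    the projection is unchanged, and the lift starts at the identity.\<close>
  define F where "F t w = (Im (g (t, w)) - (Im (g (0, w)) - fst w), snd (\<phi> t (annulus_proj w)))"
    for t w
  have "continuous_on ?S (\<lambda>x. F (fst x) (snd x))"
    unfolding F_def
    by (intro continuous_intros continuous_on_compose2[OF g(1)] continuous_on_snd[OF continuous_on_value])
       auto
  moreover have "annulus_proj (F t w) = \<phi> t (annulus_proj w)" if t: "t \<in> {0..1}" for t w
  proof -
    have "cis (Im (g (0, w))) = cis (fst w)"
      by (subst cis_g) (auto simp: at_0 annulus_proj_def)
    then have "cis (fst (F t w)) = ?E (t, w)"
      using cis_g[of "(t, w)"] t by (simp add: F_def flip: cis_divide)
    then have "circle_proj (fst (F t w)) = fst (\<phi> t (annulus_proj w))"
      by (intro circle_cis_inject) simp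
    then show ?thesis
      by (simp add: annulus_proj_def F_def)
  qed
  moreover have "F 0 w = w" for w
    by (simp add: F_def at_0 annulus_proj_def)
  ultimately have "lifted_isotopy \<phi> f F"
    by unfold_locales auto
  then show ?thesis
    by (rule exI[of _ F])
qed

context lifted_isotopy
begin

lemma continuous_on_lift_compose:
  assumes "continuous_on A g" "continuous_on A h" "\<And>x. x \<in> A \<Longrightarrow> g x \<in> {0..1}"
  shows "continuous_on A (\<lambda>x. F (g x) (h x))"
proof -
  have "(\<lambda>x. (g x, h x)) ` A \<subseteq> {0..1} \<times> UNIV"
    using assms(3) by auto
  then show ?thesis
    using continuous_on_compose2[OF continuous_on_lift continuous_on_Pair[OF assms(1,2)]] by simp
qed

lemma continuous_on_deriv_compose:
  assumes "continuous_on A g" "continuous_on A h" "\<And>x. x \<in> A \<Longrightarrow> g x \<in> {0..1}"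
  shows "continuous_on A (\<lambda>x. annulus_deriv (\<phi> (g x)) (annulus_proj (h x)))"
proof -
  have "(\<lambda>x. (g x, h x)) ` A \<subseteq> {0..1} \<times> UNIV"
    using assms(3) by auto
  then show ?thesis
    using continuous_on_compose2[OF continuous_on_deriv continuous_on_Pair[OF assms(1,2)]] by simp
qed

text \<open>The displacement between the two images is continuous in time and lies in the lattice of
  deck translations, so it keeps its value at time \<open>0\<close>.\<close>

lemma lift_translate:
  assumes t: "t \<in> {0..1}"
  shows "F t (w + (of_int k * (2 * pi), 0)) = F t w + (of_int k * (2 * pi), 0)"
proof -
  define d where "d s = F s (w + (of_int k * (2 * pi), 0)) - F s w" for s
  have proj: "annulus_proj (w + (of_int k * (2 * pi), 0)) = annulus_proj w"
    by (subst eq_commute, subst annulus_proj_eq_iff) auto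
  have lat: "\<exists>m::int. d s = (of_int m * (2 * pi), 0)" if "s \<in> {0..1}" for s
  proof -
    have "annulus_proj (F s w) = annulus_proj (F s (w + (of_int k * (2 * pi), 0)))"
      using that by (simp add: proj_lift proj)
    then show ?thesis
      unfolding annulus_proj_eq_iff d_def by force
  qed
  have "\<i> * complex_of_real (fst (d t)) = \<i> * complex_of_real (fst (d 0))"
  proof (rule exp_eq_1_imp_constant[where S = "{0..1}" and h = "\<lambda>s. \<i> * complex_of_real (fst (d s))"])
    show "connected {0..1::real}"
      by simp
    show "continuous_on {0..1} (\<lambda>t. \<i> * complex_of_real (fst (d t)))"
      unfolding d_def by (intro continuous_intros continuous_on_lift_compose) auto
    fix s :: real assume "s \<in> {0..1}"
    then have "cis (fst (d s)) = 1"
      using lat by (fastforce simp: cis_eq_1_iff)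
    then show "exp (\<i> * complex_of_real (fst (d s))) = 1"
      by (simp add: cis_conv_exp)
  qed (use t in auto)
  then have "fst (d t) = fst (d 0)"
    by (simp only: mult_cancel_left of_real_eq_iff complex_i_not_zero simp_thms)
  then have "fst (d t) = of_int k * (2 * pi)"
    by (simp add: d_def lift_0)
  moreover have "snd (d t) = 0"
    using lat[OF t] by auto
  ultimately have "d t = (of_int k * (2 * pi), 0)"
    by (simp add: prod_eq_iff)
  then show ?thesis
    by (simp add: d_def algebra_simps)
qed

text \<open>Injectivity of \<open>\<phi> t\<close> leaves only a deck translation between
  \<open>a\<close> and \<open>b\<close>, and equivariance forces it to be trivial. This is why
  chords never vanish.\<close>

lemma lift_inject:
  assumes t: "t \<in> {0..1}" and eq: "F t a = F t b"
  shows "a = b"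
proof -
  have "\<phi> t (annulus_proj a) = \<phi> t (annulus_proj b)"
    using eq t by (metis proj_lift)
  moreover have "inj (\<phi> t)"
    using in_Diff1[OF t] by (simp add: Diff1_def bij_is_inj)
  ultimately have "annulus_proj a = annulus_proj b"
    by (simp add: inj_eq)
  then obtain k :: int where b: "b = a + (of_int k * (2 * pi), 0)"
    by (auto simp: annulus_proj_eq_iff)
  then show ?thesis
    using eq lift_translate[OF t, of a k] by simp
qed

lemma is_lift_1: "is_lift (F 1) f"
  unfolding is_lift_def
  by (auto simp: proj_lift at_1 intro!: continuous_on_lift_compose continuous_intros)

lemma has_derivative_lift:
  assumes t: "t \<in> {0..1}"
  shows "(F t has_derivative blinfun_apply (annulus_deriv (\<phi> t) (annulus_proj w))) (at w)"
proof (rule has_annulus_derivative_local_lift)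
  show "has_annulus_derivative (\<phi> t) (annulus_deriv (\<phi> t) (annulus_proj w)) (annulus_proj w)"
    by (rule Diff1_has_derivative(1)[OF in_Diff1[OF t]])
  have "continuous_on UNIV (\<lambda>w. F t w)"
    using t by (intro continuous_on_lift_compose continuous_intros)
  then show "isCont (F t) w"
    by (simp add: continuous_on_eq_continuous_at)
qed (use proj_lift[OF t] in auto)

end


section \<open>Homotopies and principal arguments\<close>

text \<open>A continuous argument that is principal at time \<open>0\<close> is principal again at
  time \<open>1\<close>: the path has no net crossing of the branch cut of
  \<open>Ln\<close>.\<close>

definition principal_endpoints :: "(real \<Rightarrow> complex) \<Rightarrow> bool" where
  "principal_endpoints \<gamma> \<longleftrightarrow>
     (\<exists>l. continuous_on {0..1} l \<and> (\<forall>t\<in>{0..1}. exp (l t) = \<gamma> t) \<and> l 0 = Ln (\<gamma> 0) \<and> l 1 = Ln (\<gamma> 1))"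

lemma principal_endpoints_const: "c \<noteq> 0 \<Longrightarrow> principal_endpoints (\<lambda>_. c)"
  unfolding principal_endpoints_def by (intro exI[of _ "\<lambda>_. Ln c"]) simp

lemma principal_endpoints_cong:
  assumes "principal_endpoints \<gamma>" "\<And>t. t \<in> {0..1} \<Longrightarrow> \<gamma> t = \<delta> t"
  shows "principal_endpoints \<delta>"
  using assms by (simp add: principal_endpoints_def)

text \<open>
  Along both families of endpoints, a logarithm of the homotopy differs from the principal one by
  a constant; the two constants agree for one path, hence for all of them.
\<close>

lemma principal_endpoints_homotopy:
  fixes H :: "real \<Rightarrow> 'a::real_normed_vector \<Rightarrow> complex"
  assumes cont: "continuous_on ({0..1} \<times> S) (\<lambda>x. H (fst x) (snd x))" and "convex S"
    and nz: "\<And>t s. t \<in> {0..1} \<Longrightarrow> s \<in> S \<Longrightarrow> H t s \<noteq> 0"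
    and cut: "\<And>t s. t \<in> {0, 1} \<Longrightarrow> s \<in> S \<Longrightarrow> H t s \<notin> \<real>\<^sub>\<le>\<^sub>0"
    and s: "s \<in> S" "s' \<in> S"
    and principal: "principal_endpoints (\<lambda>t. H t s)"
  shows "principal_endpoints (\<lambda>t. H t s')"
proof -
  have "contractible ({0..1::real} \<times> S)"
    using \<open>convex S\<close> by (intro convex_imp_contractible convex_Times) auto
  then obtain g where g: "continuous_on ({0..1} \<times> S) g"
      "\<And>x. x \<in> {0..1} \<times> S \<Longrightarrow> H (fst x) (snd x) = exp (g x)"
    by (rule continuous_logarithm_on_contractible[OF cont])
       (use nz in \<open>auto simp: mem_Times_iff\<close>)
  have cont_slice: "continuous_on S (H t)" if "t \<in> {0..1}" for t
  proof -
    have "continuous_on S (\<lambda>r. H (fst (t, r)) (snd (t, r)))"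
      by (rule continuous_on_compose2[OF cont continuous_on_Pair[OF continuous_on_const continuous_on_id]])
         (use that in auto)
    then show ?thesis
      by simp
  qed
  have ends: "g (t, s') - Ln (H t s') = g (t, s) - Ln (H t s)" if t: "t \<in> {0, 1}" for t
  proof (rule exp_eq_1_imp_constant[where S = S and h = "\<lambda>r. g (t, r) - Ln (H t r)"])
    show "connected S"
      using \<open>convex S\<close> by (rule convex_connected)
    show "continuous_on S (\<lambda>r. g (t, r) - Ln (H t r))"
      by (intro continuous_on_diff continuous_on_compose2[OF g(1)] continuous_on_Ln'
            continuous_on_Pair continuous_on_const continuous_on_id cont_slice)
         (use t cut in auto)
    fix r assume r: "r \<in> S"
    have "H t r \<noteq> 0"
      using t r nz[of t r] by auto
    then show "exp (g (t, r) - Ln (H t r)) = 1"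
      using g(2)[of "(t, r)"] t r by (auto simp: exp_diff)
  qed (use s in auto)
  obtain l where l: "continuous_on {0..1} l" "\<And>t. t \<in> {0..1} \<Longrightarrow> exp (l t) = H t s"
      "l 0 = Ln (H 0 s)" "l 1 = Ln (H 1 s)"
    using principal by (auto simp: principal_endpoints_def)
  have "l 1 - g (1, s) = l 0 - g (0, s)"
  proof (rule exp_eq_1_imp_constant[where S = "{0..1}" and h = "\<lambda>t. l t - g (t, s)"])
    show "continuous_on {0..1} (\<lambda>t. l t - g (t, s))"
      by (intro continuous_on_diff l(1) continuous_on_compose2[OF g(1)]
            continuous_on_Pair continuous_on_const continuous_on_id)
         (use s in auto)
    fix t :: real assume "t \<in> {0..1}"
    then show "exp (l t - g (t, s)) = 1"
      using g(2)[of "(t, s)"] l(2)[of t] s by (simp add: exp_diff)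
  qed auto
  then have "g (1, s) - Ln (H 1 s) = g (0, s) - Ln (H 0 s)"
    unfolding l(3,4) by (metis minus_diff_eq)
  then have shift: "g (1, s') - Ln (H 1 s') = g (0, s') - Ln (H 0 s')"
    using ends[of 0] ends[of 1] by simp
  define l' where "l' t = g (t, s') - (g (0, s') - Ln (H 0 s'))" for t
  have "continuous_on {0..1} l'"
    unfolding l'_def
    by (intro continuous_on_diff continuous_on_compose2[OF g(1)]
            continuous_on_Pair continuous_on_const continuous_on_id)
         (use s in auto)
  moreover have "exp (l' t) = H t s'" if "t \<in> {0..1}" for t
  proof -
    have "H 0 s' = exp (g (0, s'))" "H t s' = exp (g (t, s'))" "H 0 s' \<noteq> 0"
      using g(2)[of "(0, s')"] g(2)[of "(t, s')"] s that nz[of 0 s'] by auto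
    then show ?thesis
      by (simp add: l'_def exp_diff)
  qed
  moreover have "l' 0 = Ln (H 0 s')" "l' 1 = Ln (H 1 s')"
    using shift by (simp_all add: l'_def algebra_simps)
  ultimately show ?thesis
    unfolding principal_endpoints_def by (intro exI[of _ l']) auto
qed

section \<open>Plane vectors as complex numbers; increasing diffeomorphisms\<close>

definition to_complex :: "plane \<Rightarrow> complex" where
  "to_complex w = Complex (fst w) (snd w)"

lemma Re_to_complex [simp]: "Re (to_complex w) = fst w"
  and Im_to_complex [simp]: "Im (to_complex w) = snd w"
  by (simp_all add: to_complex_def)

lemma to_complex_eq_0_iff [simp]: "to_complex w = 0 \<longleftrightarrow> w = 0"
  by (auto simp: complex_eq_iff prod_eq_iff)

lemma to_complex_nonpos_Reals_iff: "to_complex w \<in> \<real>\<^sub>\<le>\<^sub>0 \<longleftrightarrow> fst w \<le> 0 \<and> snd w = 0"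
  by (simp add: complex_nonpos_Reals_iff)

lemma continuous_on_to_complex [continuous_intros]:
  "continuous_on A g \<Longrightarrow> continuous_on A (\<lambda>x. to_complex (g x))"
  unfolding to_complex_def Complex_eq by (intro continuous_intros)

text \<open>Monotonicity gives a nonnegative derivative; the differentiable inverse excludes zero by
  the chain rule.\<close>

lemma increasing_diffeo_deriv_pos:
  assumes g: "increasing_diffeo g" and d: "(g has_real_derivative d) (at y)"
  shows "d > 0"
proof -
  have "mono_on UNIV g"
    using g by (auto simp: increasing_diffeo_def strict_mono_mono)
  then have "d \<ge> 0"
    using d by (rule mono_on_imp_deriv_nonneg) simp
  obtain e where "(inv g has_real_derivative e) (at (g y))"
    using g by (auto simp: increasing_diffeo_def C1_differentiable_on_def
        has_real_derivative_iff_has_vector_derivative)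
  then have "((\<lambda>x. inv g (g x)) has_real_derivative e * d) (at y)"
    using d by (rule DERIV_chain2)
  moreover have "inv g (g x) = x" for x
    using g by (simp add: increasing_diffeo_def bij_is_inj)
  ultimately have "((\<lambda>x. x) has_real_derivative e * d) (at y)"
    by simp
  then have "e * d = 1"
    using DERIV_ident DERIV_unique by blast
  with \<open>d \<ge> 0\<close> show ?thesis
    by (cases "d = 0") auto
qed

section \<open>Vertical derivatives and vertical chords\<close>

context lifted_isotopy
begin

definition vertical :: "real \<Rightarrow> plane \<Rightarrow> plane" where
  "vertical t w = blinfun_apply (annulus_deriv (\<phi> t) (annulus_proj w)) (0, 1)"

text \<open>The integral extends the chord quotients of \<open>mean_vertical_eq\<close> continuously to \<open>h = 0\<close>.\<close>

definition mean_vertical :: "plane \<Rightarrow> real \<Rightarrow> real \<Rightarrow> plane" where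
  "mean_vertical a t h = integral {0..1} (\<lambda>u. vertical t (a - (0, u * h)))"

lemma continuous_on_vertical_compose:
  assumes "continuous_on A g" "continuous_on A h" "\<And>x. x \<in> A \<Longrightarrow> g x \<in> {0..1}"
  shows "continuous_on A (\<lambda>x. vertical (g x) (h x))"
  unfolding vertical_def
  by (intro continuous_intros continuous_on_deriv_compose assms)

lemma vertical_nonzero: "t \<in> {0..1} \<Longrightarrow> vertical t w \<noteq> 0"
  using Diff1_deriv_inject[OF in_Diff1] unfolding vertical_def
  by (metis blinfun.zero_right inj_eq prod.inject zero_neq_one zero_prod_def)

lemma vertical_0: "vertical 0 w = (0, 1)"
  unfolding vertical_def at_0 by (simp add: annulus_deriv_eq[OF has_annulus_derivative_id])

lemma mean_vertical_0: "mean_vertical a t 0 = vertical t a"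
  by (simp add: mean_vertical_def flip: zero_prod_def)

text \<open>The fundamental theorem of calculus along the vertical segment between \<open>a\<close>
  and \<open>a - (0, h)\<close>.\<close>

lemma mean_vertical_eq:
  assumes t: "t \<in> {0..1}" and h: "h \<noteq> 0"
  shows "mean_vertical a t h = (1 / h) *\<^sub>R (F t a - F t (a - (0, h)))"
proof -
  \<comment> \<open>An antiderivative of the integrand; the factor \<open>- (1 / h)\<close> undoes
    the velocity \<open>(0, - h)\<close> of the moving endpoint.\<close>
  define p where "p u = - (1 / h) *\<^sub>R F t (a - (0, u * h))" for u
  have "(p has_vector_derivative vertical t (a - (0, u * h))) (at u)" for u
  proof -
    let ?w = "a - (0, u * h)"
    let ?D = "blinfun_apply (annulus_deriv (\<phi> t) (annulus_proj ?w))"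
    have "((\<lambda>u. a - (0, u * h)) has_derivative (\<lambda>s. - (0, s * h))) (at u)"
      by (auto intro!: derivative_eq_intros)
    then have "((\<lambda>u. F t (a - (0, u * h))) has_derivative (\<lambda>s. ?D (- (0, s * h)))) (at u)"
      by (rule has_derivative_compose) (rule has_derivative_lift[OF t])
    then have "(p has_derivative (\<lambda>s. - (1 / h) *\<^sub>R ?D (- (0, s * h)))) (at u)"
      unfolding p_def by (rule has_derivative_scaleR_right)
    moreover have "- (1 / h) *\<^sub>R ?D (- (0, s * h)) = s *\<^sub>R vertical t ?w" for s
    proof -
      have "- (0, s * h) = (- s * h) *\<^sub>R (0 :: real, 1 :: real)"
        by simp
      then have "?D (- (0, s * h)) = (- s * h) *\<^sub>R vertical t ?w"
        unfolding vertical_def by (metis blinfun.scaleR_right)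
      then show ?thesis
        using h by simp
    qed
    ultimately show ?thesis
      by (simp add: has_vector_derivative_def)
  qed
  then have "((\<lambda>u. vertical t (a - (0, u * h))) has_integral (p 1 - p 0)) {0..1}"
    by (intro fundamental_theorem_of_calculus) (auto intro: has_vector_derivative_at_within)
  then show ?thesis
    unfolding mean_vertical_def
    by (simp add: integral_unique p_def algebra_simps flip: zero_prod_def)
qed

lemma continuous_on_mean_vertical:
  "continuous_on ({0..1} \<times> S) (\<lambda>x. mean_vertical a (fst x) (snd x))"
proof -
  have "continuous_on (({0..1} \<times> S) \<times> cbox 0 1)
      (\<lambda>(x, u). vertical (fst x) (a - (0, u * snd x)))"
    unfolding split_beta
    by (intro continuous_on_vertical_compose continuous_intros) auto
  then have "continuous_on ({0..1} \<times> S)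
      (\<lambda>x. integral (cbox 0 1) (\<lambda>u. vertical (fst x) (a - (0, u * snd x))))"
    by (rule integral_continuous_on_param)
  then show ?thesis
    by (simp add: mean_vertical_def box_real)
qed

end


section \<open>Rotation of the vertical vector\<close>

locale lifted_twist_isotopy = lifted_isotopy +
  assumes twist: "positive_twist_map f"
begin

lemma increasing_diffeo_lift: "increasing_diffeo (\<lambda>y. fst (F 1 (x, y)))"
  using twist is_lift_1 by (simp add: positive_twist_map_def)

lemma lift_twist: "y < y' \<Longrightarrow> fst (F 1 (x, y)) < fst (F 1 (x, y'))"
  using increasing_diffeo_lift[of x] by (simp add: increasing_diffeo_def strict_mono_def)

text \<open>Strict monotonicity would only give a nonnegative value; the differentiable inverse on
  each vertical line makes it positive. This keeps the limit of the chords off the branch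
  cut.\<close>

lemma vertical_1_pos: "fst (vertical 1 a) > 0"
proof -
  have "((\<lambda>y. (fst a, y)) has_derivative (\<lambda>s. (0, s))) (at (snd a))"
    by (auto intro!: derivative_eq_intros)
  then have "((\<lambda>y. F 1 (fst a, y)) has_derivative
      (\<lambda>s. blinfun_apply (annulus_deriv (\<phi> 1) (annulus_proj a)) (0, s))) (at (snd a))"
    by (rule has_derivative_compose) (use has_derivative_lift[of 1 a] in simp)
  then have "((\<lambda>y. fst (F 1 (fst a, y))) has_derivative
      (\<lambda>s. fst (blinfun_apply (annulus_deriv (\<phi> 1) (annulus_proj a)) (0, s)))) (at (snd a))"
    by (rule has_derivative_fst)
  moreover have "blinfun_apply (annulus_deriv (\<phi> 1) (annulus_proj a)) (0, s) = s *\<^sub>R vertical 1 a" for s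
    unfolding vertical_def by (simp flip: blinfun.scaleR_right)
  ultimately have "((\<lambda>y. fst (F 1 (fst a, y))) has_real_derivative fst (vertical 1 a)) (at (snd a))"
    by (simp add: has_field_derivative_def mult_commute_abs)
  with increasing_diffeo_lift show ?thesis
    by (rule increasing_diffeo_deriv_pos)
qed

text \<open>Surjectivity in the twist condition gives a suitable depth for each \<open>s\<close>,
  monotonicity makes every greater depth suitable, and compactness of \<open>{0..2 * pi}\<close>
  makes one depth work for all \<open>s\<close>.\<close>

lemma far_below:
  obtains h where "h > 0"
    "\<And>s. s \<in> {0..2 * pi} \<Longrightarrow> fst (F 1 (a - (s, h))) < fst (F 1 a)"
proof -
  define U where "U n = {s. fst (F 1 (a - (s, real n))) < fst (F 1 a)}" for n :: nat
  have mono: "U m \<subseteq> U n" if "m \<le> n" for m n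
  proof
    fix s assume "s \<in> U m"
    moreover have "fst (F 1 (a - (s, real n))) \<le> fst (F 1 (a - (s, real m)))"
      using that lift_twist[of "snd a - real n" "snd a - real m" "fst a - s"]
      by (cases a) (force simp: le_less)
    ultimately show "s \<in> U n"
      by (simp add: U_def)
  qed
  have op: "open (U n)" for n
    unfolding U_def
    by (intro open_Collect_less continuous_on_fst continuous_on_lift_compose continuous_intros) auto
  have cover: "{0..2 * pi} \<subseteq> (\<Union>n. U n)"
  proof
    fix s :: real
    have "bij (\<lambda>y. fst (F 1 (fst a - s, y)))"
      using increasing_diffeo_lift by (simp add: increasing_diffeo_def)
    from surjD[OF bij_is_surj[OF this], of "fst (F 1 a) - 1"]
    obtain y where y: "fst (F 1 a) - 1 = fst (F 1 (fst a - s, y))" ..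
    obtain n where "snd a - y < real n"
      using reals_Archimedean2 by blast
    then have "fst (F 1 (fst a - s, snd a - real n)) < fst (F 1 (fst a - s, y))"
      by (intro lift_twist) simp
    then have "s \<in> U n"
      using y by (cases a) (simp add: U_def)
    then show "s \<in> (\<Union>n. U n)"
      by blast
  qed
  obtain N where N: "finite N" "{0..2 * pi} \<subseteq> (\<Union>n\<in>N. U n)"
    by (rule compactE_image[OF compact_Icc op cover])
  \<comment> \<open>The successor makes the depth positive even if \<open>Max N\<close> is
    \<open>0\<close>.\<close>
  have "{0..2 * pi} \<subseteq> U (Suc (Max N))"
  proof
    fix s assume "s \<in> {0..2 * pi}"
    then obtain n where n: "n \<in> N" "s \<in> U n"
      using N(2) by blast
    then have "n \<le> Suc (Max N)"
      using N(1) by (simp add: le_SucI)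
    then show "s \<in> U (Suc (Max N))"
      using mono n by blast
  qed
  then show ?thesis
    by (intro that[of "real (Suc (Max N))"]) (auto simp: U_def)
qed

lemma principal_endpoints_vertical: "principal_endpoints (\<lambda>t. to_complex (vertical t a))"
proof -
  obtain h where h: "h > 0"
    and below: "\<And>s. s \<in> {0..2 * pi} \<Longrightarrow> fst (F 1 (a - (s, h))) < fst (F 1 a)"
    by (rule far_below[of a], rule that) simp_all
  \<comment> \<open>\<open>b\<close> is the displacement from the second endpoint to
    \<open>a\<close>; the factor \<open>1 / h\<close> makes \<open>chord t (0, h)\<close> equal to
    \<open>mean_vertical a t h\<close>, where the last homotopy begins.\<close>
  define chord where "chord t b = (1 / h) *\<^sub>R (F t a - F t (a - b))" for t b
  have cont: "continuous_on A (\<lambda>x. chord (p x) (q x))"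
    if "continuous_on A p" "continuous_on A q" "\<And>x. x \<in> A \<Longrightarrow> p x \<in> {0..1}"
    for A and p :: "real \<times> real \<Rightarrow> real" and q
    unfolding chord_def using that
    by (intro continuous_intros continuous_on_lift_compose)
  have nz: "chord t b \<noteq> 0" if "t \<in> {0..1}" "b \<noteq> 0" for t b
    using lift_inject[OF that(1), of a "a - b"] that(2) h by (auto simp: chord_def)
  have chord_0: "chord 0 b = (1 / h) *\<^sub>R b" for b
    by (simp add: chord_def lift_0)
  have chord_00: "chord t (0, 0) = 0" for t
    by (simp add: chord_def flip: zero_prod_def)
  have chord_2pi: "chord t (2 * pi, y) = chord t (0, y) + (2 * pi / h, 0)" if "t \<in> {0..1}" for t y
  proof -
    have "F t (a - (0, y)) = F t (a - (2 * pi, y)) + (2 * pi, 0)"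
      using lift_translate[OF that, of "a - (2 * pi, y)" 1] by (cases a) simp
    then show ?thesis
      by (simp add: chord_def algebra_simps)
  qed
  have chord_1: "fst (chord 1 (0, y)) > 0" if "y > 0" for y
    using lift_twist[of "snd a - y" "snd a" "fst a"] that h by (cases a) (simp add: chord_def)

  \<comment> \<open>The starting path: by equivariance, the chord over one full period is constant
    in time.\<close>
  have "to_complex (2 * pi / h, 0) \<noteq> 0"
    using h by (simp add: zero_prod_def)
  then have "principal_endpoints (\<lambda>t. to_complex (chord t (2 * pi, 0)))"
    by (rule principal_endpoints_cong[OF principal_endpoints_const]) (simp add: chord_2pi chord_00)
  \<comment> \<open>Lowering the endpoint: at times \<open>0\<close> and \<open>1\<close> the first
    component is that of \<open>chord t (0, s)\<close>, which is nonnegative, plus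
    \<open>2 * pi / h\<close>.\<close>
  then have "principal_endpoints (\<lambda>t. to_complex (chord t (2 * pi, h)))"
  proof (rule principal_endpoints_homotopy[where S = "{0..h}", rotated -1])
    show "continuous_on ({0..1} \<times> {0..h}) (\<lambda>x. to_complex (chord (fst x) (2 * pi, snd x)))"
      by (intro continuous_intros cont) auto
    fix t s :: real assume s: "s \<in> {0..h}"
    show "to_complex (chord t (2 * pi, s)) \<noteq> 0" if "t \<in> {0..1}"
      using nz[OF that, of "(2 * pi, s)"] by (simp add: zero_prod_def)
    show "to_complex (chord t (2 * pi, s)) \<notin> \<real>\<^sub>\<le>\<^sub>0" if "t \<in> {0, 1}"
    proof -
      have "fst (chord t (0, s)) \<ge> 0"
        using that s chord_1[of s] h by (cases "s = 0") (auto simp: chord_0 chord_00)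
      then have "fst (chord t (2 * pi, s)) > 0"
        using that h by (subst chord_2pi) (auto intro: add_nonneg_pos)
      then show ?thesis
        by (simp add: to_complex_nonpos_Reals_iff)
    qed
  qed (use h in auto)
  \<comment> \<open>Sliding the endpoint at depth \<open>h\<close>: at time \<open>0\<close> the
    second component is \<open>1\<close>; at time \<open>1\<close> the choice of \<open>h\<close>
    makes the first component positive.\<close>
  then have "principal_endpoints (\<lambda>t. to_complex (chord t (0, h)))"
  proof (rule principal_endpoints_homotopy[where S = "{0..2 * pi}", rotated -1])
    show "continuous_on ({0..1} \<times> {0..2 * pi}) (\<lambda>x. to_complex (chord (fst x) (snd x, h)))"
      by (intro continuous_intros cont) auto
    fix t s :: real assume s: "s \<in> {0..2 * pi}"
    show "to_complex (chord t (s, h)) \<noteq> 0" if "t \<in> {0..1}"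
      using nz[OF that, of "(s, h)"] h by (simp add: zero_prod_def)
    show "to_complex (chord t (s, h)) \<notin> \<real>\<^sub>\<le>\<^sub>0" if "t \<in> {0, 1}"
    proof (cases "t = 0")
      case True
      then show ?thesis
        using h by (simp add: to_complex_nonpos_Reals_iff chord_0)
    next
      case False
      then have "fst (chord t (s, h)) > 0"
        using that below[OF s] h by (simp add: chord_def)
      then show ?thesis
        by (simp add: to_complex_nonpos_Reals_iff)
    qed
  qed auto
  then have "principal_endpoints (\<lambda>t. to_complex (mean_vertical a t h))"
    by (rule principal_endpoints_cong) (use h in \<open>simp add: mean_vertical_eq chord_def\<close>)
  \<comment> \<open>Raising the endpoint: dividing by the current height instead of \<open>h\<close>
    keeps the limit nonzero. At time \<open>0\<close> the mean is always
    \<open>(0, 1)\<close>.\<close>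
  then have "principal_endpoints (\<lambda>t. to_complex (mean_vertical a t 0))"
  proof (rule principal_endpoints_homotopy[where S = "{0..h}", rotated -1])
    show "continuous_on ({0..1} \<times> {0..h}) (\<lambda>x. to_complex (mean_vertical a (fst x) (snd x)))"
      by (intro continuous_intros continuous_on_mean_vertical)
    fix t s :: real assume s: "s \<in> {0..h}"
    show "to_complex (mean_vertical a t s) \<noteq> 0" if t: "t \<in> {0..1}"
    proof (cases "s = 0")
      case True
      then show ?thesis
        using vertical_nonzero[OF t] by (simp add: mean_vertical_0)
    next
      case False
      then have "F t a \<noteq> F t (a - (0, s))"
        using lift_inject[OF t, of a "a - (0, s)"] by (auto simp: zero_prod_def)
      then show ?thesis
        using False by (simp add: mean_vertical_eq[OF t])
    qed
    show "to_complex (mean_vertical a t s) \<notin> \<real>\<^sub>\<le>\<^sub>0" if t: "t \<in> {0, 1}"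
    proof (cases "t = 0")
      case True
      then show ?thesis
        by (cases "s = 0")
           (simp_all add: to_complex_nonpos_Reals_iff mean_vertical_0 vertical_0 mean_vertical_eq lift_0)
    next
      case False
      then have [simp]: "t = 1"
        using t by simp
      have "fst (mean_vertical a t s) > 0"
        using s lift_twist[of "snd a - s" "snd a" "fst a"] vertical_1_pos[of a]
        by (cases a; cases "s = 0") (simp_all add: mean_vertical_0 mean_vertical_eq)
      then show ?thesis
        by (simp add: to_complex_nonpos_Reals_iff)
    qed
  qed (use h in auto)
  then show ?thesis
    by (simp add: mean_vertical_0)
qed

end


section \<open>Iteration\<close>

lemma sgn_exp_complex: "sgn (exp z) = cis (Im z)"
  by (simp add: exp_eq_polar sgn_mult sgn_of_real)

text \<open>Angles are measured from \<open>(0, 1)\<close>, which is \<open>\<i>\<close>, so they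
  are arguments of \<open>to_complex w / \<i>\<close>.\<close>

lemma oriented_angle_vertical:
  assumes "w \<noteq> 0"
  shows "circle_proj x = oriented_angle (0, 1) w \<longleftrightarrow> cis x = sgn (to_complex w / \<i>)"
proof -
  have "oriented_angle (0, 1) w = circle_proj (Arg (to_complex w / \<i>))"
    by (simp add: oriented_angle_def to_complex_def Complex_eq)
  moreover have "cis (Arg (to_complex w / \<i>)) = sgn (to_complex w / \<i>)"
    using assms by (intro cis_Arg) simp
  ultimately show ?thesis
    by (simp add: circle_proj_eq_iff_cis)
qed

text \<open>Finitely many closed pieces can be glued, and each point has some
  \<open>{0..real n}\<close> as a neighbourhood in the half-line.\<close>

lemma continuous_on_atLeast_0_pieces:
  fixes g :: "real \<Rightarrow> 'a::topological_space"
  assumes "\<And>n. continuous_on {real n..real n + 1} g"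
  shows "continuous_on {0..} g"
proof -
  have initial: "continuous_on {0..real n} g" for n
  proof (induction n)
    case (Suc n)
    have "continuous_on ({0..real n} \<union> {real n..real n + 1}) g"
      by (intro continuous_on_closed_Un Suc assms) auto
    moreover have "{0..real n} \<union> {real n..real n + 1} = {0..real (Suc n)}"
      by auto
    ultimately show ?case
      by simp
  qed simp
  show ?thesis
    unfolding continuous_on_eq_continuous_within
  proof
    fix x :: real
    assume "x \<in> {0..}"
    obtain n where n: "x < real n"
      using reals_Archimedean2 by blast
    then have "continuous (at x within {0..real n}) g"
      using initial[of n] \<open>x \<in> {0..}\<close> by (simp add: continuous_on_eq_continuous_within)
    moreover have "at x within {0..real n} = at x within {0..}"
      by (rule at_within_nhd[of x "{..<real n}"]) (use n in auto)
    ultimately show "continuous (at x within {0..}) g"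
      by (simp add: continuous_within)
  qed
qed

section \<open>Angles under injective linear maps\<close>

lemma sin_angle_diff_eq_0_iff:
  assumes "cis \<alpha> = sgn z" "cis \<beta> = sgn w" "z \<noteq> 0" "w \<noteq> 0"
  shows "sin (\<alpha> - \<beta>) = 0 \<longleftrightarrow> Im (z * cnj w) = 0"
proof -
  \<comment> \<open>\<open>z * cnj w\<close> has argument \<open>\<alpha> - \<beta>\<close> modulo
    \<open>2 * pi\<close>; its imaginary part is, up to sign, the determinant of the two
    vectors.\<close>
  have "cis (\<alpha> - \<beta>) = cis \<alpha> * cnj (cis \<beta>)"
    by (simp add: cis_cnj cis_mult)
  also have "\<dots> = (z * cnj w) /\<^sub>R (norm z * norm w)"
    unfolding assms(1,2) by (simp add: sgn_div_norm)
  finally have "Im (cis (\<alpha> - \<beta>)) = Im (z * cnj w) / (norm z * norm w)"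
    by (simp add: divide_inverse_commute)
  then show ?thesis
    using assms(3,4) by simp
qed

lemma inj_vertical_nonzero:
  fixes L :: "plane \<Rightarrow>\<^sub>L plane"
  assumes "inj (blinfun_apply L)"
  shows "L (0, 1) \<noteq> 0"
proof -
  have "L (0, 1) \<noteq> L 0"
    using assms by (simp add: inj_eq zero_prod_def)
  then show ?thesis
    by (simp add: blinfun.zero_right)
qed

text \<open>Injective linear maps preserve and reflect parallelism. The right-hand side does not
  mention \<open>L\<close>: along an isotopy, the two images are parallel at all times or at
  none.\<close>

lemma parallel_to_vertical_image_iff:
  fixes L :: "plane \<Rightarrow>\<^sub>L plane"
  assumes "inj (blinfun_apply L)"
  shows "Im (to_complex (L \<xi>) * cnj (to_complex (L (0, 1)))) = 0 \<longleftrightarrow> fst \<xi> = 0"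
proof
  assume det: "Im (to_complex (L \<xi>) * cnj (to_complex (L (0, 1)))) = 0"
  have "L (0, 1) \<noteq> 0"
    using assms by (rule inj_vertical_nonzero)
  \<comment> \<open>The ratio is taken in a coordinate where \<open>L (0, 1)\<close> does not
    vanish.\<close>
  define k where "k = (if fst (L (0, 1)) = 0 then snd (L \<xi>) / snd (L (0, 1))
    else fst (L \<xi>) / fst (L (0, 1)))"
  have "L \<xi> = k *\<^sub>R L (0, 1)"
    using det \<open>L (0, 1) \<noteq> 0\<close> by (auto simp: prod_eq_iff k_def field_simps)
  then have "L \<xi> = L (k *\<^sub>R (0, 1))"
    by (simp only: blinfun.scaleR_right)
  then have "\<xi> = k *\<^sub>R (0, 1)"
    using assms by (simp only: inj_eq)
  then show "fst \<xi> = 0"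
    by simp
next
  assume "fst \<xi> = 0"
  then have "\<xi> = snd \<xi> *\<^sub>R (0, 1)"
    by (simp add: prod_eq_iff)
  then have "L \<xi> = snd \<xi> *\<^sub>R L (0, 1)"
    by (metis blinfun.scaleR_right)
  then show "Im (to_complex (L \<xi>) * cnj (to_complex (L (0, 1)))) = 0"
    by simp
qed

text \<open>The sine of \<open>w\<close> vanishes at all times or never. Crossing \<open>c\<close>
  would make it vanish once, yet it would be nonzero slightly above \<open>c\<close>.\<close>

lemma stays_le_multiple_of_pi:
  fixes w :: "real \<Rightarrow> real"
  assumes w: "continuous_on {0..1} w"
    and sin: "\<And>s t. s \<in> {0..1} \<Longrightarrow> t \<in> {0..1} \<Longrightarrow> sin (w s) = 0 \<Longrightarrow> sin (w t) = 0"
    and c: "sin c = 0" and "w 0 \<le> c"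
  shows "w 1 \<le> c"
proof (rule ccontr)
  assume "\<not> w 1 \<le> c"
  then have "c < w 1"
    by simp
  \<comment> \<open>A value strictly between \<open>c\<close> and \<open>c + pi\<close>, hence not a
    zero of the sine, and low enough to be attained by \<open>w\<close>.\<close>
  define c' where "c' = min (w 1) (c + pi / 2)"
  have c': "c < c'" "c' < c + pi" "c' \<le> w 1"
    using \<open>c < w 1\<close> by (auto simp: c'_def min_def)
  obtain s where s: "s \<in> {0..1}" "w s = c"
    using IVT'[of w 0 c 1] w \<open>w 0 \<le> c\<close> \<open>c < w 1\<close> by auto
  obtain t where t: "t \<in> {0..1}" "w t = c'"
    using IVT'[of w 0 c' 1] w \<open>w 0 \<le> c\<close> c' by auto
  have "sin c' = 0"
    using sin[OF s(1) t(1)] s t c by simp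
  moreover have "sin c' = sin (c' - c) * cos c + cos (c' - c) * sin c"
    using sin_add[of "c' - c" c] by simp
  moreover have "sin (c' - c) > 0"
    using c' by (intro sin_gt_zero) auto
  moreover have "cos c \<noteq> 0"
    using c sin_cos_squared_add[of c] by auto
  ultimately show False
    using c by simp
qed

context isotopy
begin

text \<open>At time \<open>1\<close> the vertical vector points into the right half-plane, so its
  principal argument is between \<open>- pi / 2\<close> and \<open>pi / 2\<close>. Subtracting
  \<open>pi / 2\<close>, the argument of \<open>\<i>\<close>, measures it from the vertical;
  \<open>principal_endpoints_vertical\<close> excludes further turns.\<close>

lemma vertical_rotation:
  assumes "positive_twist_map f"
  obtains u where "continuous_on {0..1} u" "u 0 = 0" "- pi < u 1" "u 1 < 0"
    "\<And>t. t \<in> {0..1} \<Longrightarrow>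
      cis (u t) = sgn (to_complex (blinfun_apply (annulus_deriv (\<phi> t) z) (0, 1)) / \<i>)"
proof -
  obtain F where "lifted_isotopy \<phi> f F"
    using ex_lifted_isotopy by blast
  then interpret lifted_twist_isotopy \<phi> f F
    using assms by (intro lifted_twist_isotopy.intro) (auto simp: lifted_twist_isotopy_axioms_def)
  obtain a where a: "annulus_proj a = z"
    by (rule annulus_proj_surj)
  obtain l where l: "continuous_on {0..1} l" "\<And>t. t \<in> {0..1} \<Longrightarrow> exp (l t) = to_complex (vertical t a)"
      "l 0 = Ln (to_complex (vertical 0 a))" "l 1 = Ln (to_complex (vertical 1 a))"
    using principal_endpoints_vertical[of a] by (auto simp: principal_endpoints_def)
  define u where "u t = Im (l t) - pi / 2" for t
  have "to_complex (0, 1) = \<i>"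
    by (simp add: complex_eq_iff)
  then have "u 0 = 0"
    by (simp add: u_def l(3) vertical_0)
  moreover have "\<bar>Im (l 1)\<bar> < pi / 2"
    using vertical_1_pos[of a] vertical_nonzero[of 1 a] Re_Ln_pos_lt[of "to_complex (vertical 1 a)"]
    by (simp add: l(4))
  then have "- pi < u 1" "u 1 < 0"
    by (auto simp: u_def)
  moreover have "continuous_on {0..1} u"
    unfolding u_def by (intro continuous_intros l(1))
  moreover have "cis (u t) = sgn (to_complex (blinfun_apply (annulus_deriv (\<phi> t) z) (0, 1)) / \<i>)"
    if "t \<in> {0..1}" for t
  proof -
    have "cis (u t) = sgn (exp (l t)) / \<i>"
      by (simp add: u_def sgn_exp_complex flip: cis_divide)
    also have "\<dots> = sgn (exp (l t) / \<i>)"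
      by (simp add: sgn_div_norm norm_mult)
    finally show ?thesis
      using l(2)[OF that] by (simp add: vertical_def a)
  qed
  ultimately show ?thesis
    using that[of u] by blast
qed

lemma deriv_funpow:
  "has_annulus_derivative (f ^^ n) (annulus_deriv (f ^^ n) z) z"
  "inj (blinfun_apply (annulus_deriv (f ^^ n) z))"
proof (induction n)
  case 0
  have "annulus_deriv (f ^^ 0) z = id_blinfun"
    using annulus_deriv_eq[OF has_annulus_derivative_id] by (simp add: id_def)
  then show "has_annulus_derivative (f ^^ 0) (annulus_deriv (f ^^ 0) z) z"
    "inj (blinfun_apply (annulus_deriv (f ^^ 0) z))"
    using has_annulus_derivative_id by (auto simp: id_def inj_on_def)
next
  case (Suc n)
  have f: "f \<in> Diff1"
    using in_Diff1[of 1] by (simp add: at_1)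
  have D: "has_annulus_derivative (f ^^ Suc n)
      (annulus_deriv f ((f ^^ n) z) o\<^sub>L annulus_deriv (f ^^ n) z) z"
    using has_annulus_derivative_compose[OF Suc(1) Diff1_has_derivative(1)[OF f]] by simp
  then show "has_annulus_derivative (f ^^ Suc n) (annulus_deriv (f ^^ Suc n) z) z"
    by (simp add: annulus_deriv_eq)
  show "inj (blinfun_apply (annulus_deriv (f ^^ Suc n) z))"
    unfolding annulus_deriv_eq[OF D]
    using inj_compose[OF Diff1_deriv_inject[OF f] Suc(2)] by (simp add: blinfun_compose.rep_eq)
qed

text \<open>The right endpoint is included because \<open>\<phi> 0 = id\<close>: at the next integer
  the definition switches to \<open>\<phi> 0 \<circ> (f ^^ Suc n)\<close>, which equals
  \<open>\<phi> 1 \<circ> (f ^^ n)\<close>. Closed time intervals can thus be glued.\<close>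

lemma extend_isotopy_eq:
  assumes "t \<in> {0..1}"
  shows "extend_isotopy \<phi> (real n + t) = \<phi> t \<circ> (f ^^ n)"
proof (cases "t = 1")
  case True
  have "extend_isotopy \<phi> (real (Suc n)) = f ^^ Suc n"
    by (simp only: extend_isotopy_def frac_def floor_of_nat of_int_of_nat_eq diff_self nat_int
          at_0 at_1 id_comp)
  then show ?thesis
    using True by (simp add: at_1 add.commute)
next
  case False
  then have "\<lfloor>real n + t\<rfloor> = int n"
    using assms by (intro floor_unique) auto
  then show ?thesis
    by (simp add: extend_isotopy_def frac_def at_1)
qed

lemma deriv_extend_isotopy:
  assumes "t \<in> {0..1}"
  shows "annulus_deriv (extend_isotopy \<phi> (real n + t)) z =
    annulus_deriv (\<phi> t) ((f ^^ n) z) o\<^sub>L annulus_deriv (f ^^ n) z"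
  unfolding extend_isotopy_eq[OF assms]
  by (intro annulus_deriv_eq has_annulus_derivative_compose deriv_funpow Diff1_has_derivative
        in_Diff1 assms)

lemma deriv_extend_isotopy_nonzero:
  assumes "t \<ge> 0"
  shows "blinfun_apply (annulus_deriv (extend_isotopy \<phi> t) z) (0, 1) \<noteq> 0"
proof -
  define n where "n = nat \<lfloor>t\<rfloor>"
  have t: "t = real n + frac t" "frac t \<in> {0..1}"
    using assms by (auto simp: n_def frac_def less_imp_le frac_lt_1) linarith
  have "inj (blinfun_apply (annulus_deriv (extend_isotopy \<phi> t) z))"
    using inj_compose[OF Diff1_deriv_inject[OF in_Diff1[OF t(2)]] deriv_funpow(2)]
    by (subst t(1)) (simp add: deriv_extend_isotopy[OF t(2)] blinfun_compose.rep_eq)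
  then show ?thesis
    by (rule inj_vertical_nonzero)
qed

lemma continuous_on_deriv_extend_isotopy:
  "continuous_on {0..} (\<lambda>t. annulus_deriv (extend_isotopy \<phi> t) z)"
proof (rule continuous_on_atLeast_0_pieces)
  fix n
  have "continuous_on {real n..real n + 1}
      (\<lambda>t. annulus_deriv (\<phi> (t - real n)) ((f ^^ n) z) o\<^sub>L annulus_deriv (f ^^ n) z)"
    by (intro bounded_bilinear.continuous_on[OF bounded_bilinear_blinfun_compose]
          continuous_on_compose2[OF continuous_on_deriv_time] continuous_intros) auto
  moreover have "annulus_deriv (\<phi> (t - real n)) ((f ^^ n) z) o\<^sub>L annulus_deriv (f ^^ n) z =
      annulus_deriv (extend_isotopy \<phi> t) z" if "t \<in> {real n..real n + 1}" for t
    using deriv_extend_isotopy[of "t - real n" n z] that by simp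
  ultimately show "continuous_on {real n..real n + 1} (\<lambda>t. annulus_deriv (extend_isotopy \<phi> t) z)"
    by (rule continuous_on_eq)
qed

text \<open>The image vector never vanishes, so its quotient by \<open>\<i>\<close> has a continuous
  logarithm on the contractible half-line; the imaginary part is an angle lift.\<close>

lemma ex_angle_lift: "\<exists>v. is_angle_lift \<phi> z (0, 1) v"
proof -
  let ?w = "\<lambda>t. blinfun_apply (annulus_deriv (extend_isotopy \<phi> t) z) (0, 1)"
  have cont: "continuous_on {0..} (\<lambda>t. to_complex (?w t) / \<i>)"
    by (intro continuous_intros continuous_on_deriv_extend_isotopy) auto
  have ctr: "contractible {0::real..}"
    by (intro convex_imp_contractible) simp
  have nz: "to_complex (?w t) / \<i> \<noteq> 0" if "t \<in> {0..}" for t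
    using deriv_extend_isotopy_nonzero[of t z] that by simp
  obtain l where l: "continuous_on {0..} l" "\<And>t. t \<in> {0..} \<Longrightarrow> to_complex (?w t) / \<i> = exp (l t)"
    by (rule continuous_logarithm_on_contractible[OF cont ctr nz], assumption, rule that) simp_all
  have "circle_proj (Im (l t)) = oriented_angle (0, 1) (?w t)" if "t \<ge> 0" for t
    unfolding oriented_angle_vertical[OF deriv_extend_isotopy_nonzero[OF that]]
    using l(2)[of t] that by (simp only: atLeast_iff sgn_exp_complex)
  then have "is_angle_lift \<phi> z (0, 1) (\<lambda>t. Im (l t))"
    unfolding is_angle_lift_def by (auto intro!: continuous_on_Im l(1))
  then show ?thesis
    by (rule exI[of _ "\<lambda>t. Im (l t)"])
qed

lemma angle_lift_bounds:
  assumes twist: "positive_twist_map f" and v: "is_angle_lift \<phi> z (0, 1) v"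
    and "n \<noteq> 0"
  shows "v (real n) - v 0 \<in> {- (real n * pi)<..<0}"
proof -
  let ?w = "\<lambda>t. blinfun_apply (annulus_deriv (extend_isotopy \<phi> t) z) (0, 1)"
  have cont_v: "continuous_on {0..} v"
    using v by (simp add: is_angle_lift_def)
  have cis_v: "cis (v t) = sgn (to_complex (?w t) / \<i>)" if "t \<ge> 0" for t
    using v that by (simp add: is_angle_lift_def oriented_angle_vertical deriv_extend_isotopy_nonzero)
  have "?w 0 = (0, 1)"
    by (simp add: extend_isotopy_def at_0 annulus_deriv_eq[OF has_annulus_derivative_id])
  moreover have "to_complex (0, 1) = \<i>"
    by (simp add: complex_eq_iff)
  \<comment> \<open>\<open>v 0\<close> is some multiple of \<open>2 * pi\<close>, so
    \<open>v t - v 0\<close> is again an angle of the image vector.\<close>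
  ultimately have cis_v0: "cis (v 0) = 1"
    using cis_v[of 0] by simp
  \<comment> \<open>Closed bounds suffice as hypothesis and hold for \<open>n = 0\<close>; the next
    unit of time makes them strict.\<close>
  have step: "v (real (Suc n)) - v 0 \<in> {- (real (Suc n) * pi)<..<0}"
    if IH: "v (real n) - v 0 \<in> {- (real n * pi)..0}" for n
  proof -
    let ?y = "(f ^^ n) z"
    define \<xi> where "\<xi> = blinfun_apply (annulus_deriv (f ^^ n) z) (0, 1)"
    obtain u where u: "continuous_on {0..1} u" "u 0 = 0" "- pi < u 1" "u 1 < 0"
      and cis_u: "\<And>t. t \<in> {0..1} \<Longrightarrow>
        cis (u t) = sgn (to_complex (blinfun_apply (annulus_deriv (\<phi> t) ?y) (0, 1)) / \<i>)"
      by (rule vertical_rotation[OF twist, of ?y], rule that) simp_all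
    \<comment> \<open>The angle from the image of the vertical vector at \<open>?y\<close> to the
      image of \<open>\<xi>\<close>, both under the derivative of \<open>\<phi> t\<close>.\<close>
    define d where "d t = (v (real n + t) - v 0) - u t" for t
    have cont_d: "continuous_on {0..1} d"
      unfolding d_def by (intro continuous_intros u(1) continuous_on_compose2[OF cont_v]) auto
    have sin_d: "sin (d t) = 0 \<longleftrightarrow> fst \<xi> = 0" if t: "t \<in> {0..1}" for t
    proof -
      let ?L = "annulus_deriv (\<phi> t) ?y"
      have w: "?w (real n + t) = blinfun_apply ?L \<xi>"
        by (simp add: deriv_extend_isotopy[OF t] \<xi>_def)
      have inj: "inj (blinfun_apply ?L)"
        using t by (intro Diff1_deriv_inject in_Diff1)
      have nz: "blinfun_apply ?L \<xi> \<noteq> 0" "blinfun_apply ?L (0, 1) \<noteq> 0"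
        using deriv_extend_isotopy_nonzero[of "real n + t" z] t w inj_vertical_nonzero[OF inj]
        by auto
      have "cis (v (real n + t) - v 0) = sgn (to_complex (blinfun_apply ?L \<xi>) / \<i>)"
        using cis_v[of "real n + t"] t w by (simp add: cis_v0 flip: cis_divide)
      then have "sin (d t) = 0 \<longleftrightarrow> Im ((to_complex (blinfun_apply ?L \<xi>) / \<i>)
          * cnj (to_complex (blinfun_apply ?L (0, 1)) / \<i>)) = 0"
        unfolding d_def by (rule sin_angle_diff_eq_0_iff[OF _ cis_u[OF t]]) (use nz in auto)
      also have "\<dots> \<longleftrightarrow> fst \<xi> = 0"
        using parallel_to_vertical_image_iff[OF inj, of \<xi>] by simp
      finally show ?thesis .
    qed
    \<comment> \<open>\<open>d 0\<close> lies between \<open>- (real n * pi)\<close> and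
      \<open>0\<close>, and \<open>d\<close> can cross neither; the lower bound follows by passing
      to \<open>- d\<close>. Then \<open>u 1\<close> is added.\<close>
    have "d 1 \<le> 0"
      by (rule stays_le_multiple_of_pi[OF cont_d]) (use sin_d IH u in \<open>auto simp: d_def\<close>)
    moreover have "- d 1 \<le> real n * pi"
      by (rule stays_le_multiple_of_pi[of "\<lambda>t. - d t"])
         (use sin_d IH u in \<open>auto simp: d_def[of 0] intro: continuous_on_minus[OF cont_d]\<close>)
    ultimately show ?thesis
      using u by (simp add: d_def add.commute algebra_simps)
  qed
  have bounds: "v (real m) - v 0 \<in> {- (real m * pi)..0}" for m
  proof (induction m)
    case (Suc m)
    then show ?case
      using step[of m] by simp
  qed simp
  show ?thesis
    using step[OF bounds, of "n - 1"] \<open>n \<noteq> 0\<close> by simp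
qed

end

theorem theorem1p2:
  fixes f :: "annulus \<Rightarrow> annulus"
    and \<phi> :: "real \<Rightarrow> annulus \<Rightarrow> annulus"
    and z :: annulus
    and n :: nat
  assumes "positive_twist_map f"
    and "isotopy_from_id \<phi> f"
    and "n \<noteq> 0"
  shows "torsion n \<phi> z (0, 1) \<in> {-pi<..<0}"
proof -
  interpret isotopy \<phi> f
    using assms(2) by unfold_locales
  \<comment> \<open>The lift selected in \<open>torsion\<close>; the bounds hold for every angle
    lift.\<close>
  define v where "v = (SOME v. is_angle_lift \<phi> z (0, 1) v)"
  have "is_angle_lift \<phi> z (0, 1) v"
    unfolding v_def by (rule someI_ex[OF ex_angle_lift])
  then have "v (real n) - v 0 \<in> {- (real n * pi)<..<0}"
    using assms(1,3) by (intro angle_lift_bounds)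
  then show ?thesis
    using assms(3) by (simp add: torsion_def Let_def field_simps flip: v_def)
qed

end
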